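(* If $p,q\in(1,\infty)$ and $r,s\in(0,1)$, then $$\sin_{p,q}(\sqrt{rs})\geq \sqrt{\sin_{p,q}(r)\,\sin_{p,q}(s)}$$ and $$\sinh_{p,q}(\sqrt{rs})\leq \sqrt{\sinh_{p,q}(r)\,\sinh_{p,q}(s)}.$$
   Context: For real $p,q>1$, define $\arcsin_{p,q}(x)=\int_0^x(1-t^q)^{-1/p}\,dt$ for $x\in[0,1]$ and $\frac{\pi_{p,q}}{2}=\int_0^1(1-t^q)^{-1/p}\,dt$ (a finite number). Then $\arcsin_{p,q}:[0,1]\to[0,\pi_{p,q}/2]$ is an increasing homeomorphism, and $\sin_{p,q}:[0,\pi_{p,q}/2]\to[0,1]$ denotes its inverse. Define $\mathrm{arcsinh}_{p,q}(x)=\int_0^x(1+t^q)^{-1/p}\,dt$ for $x\in(0,\infty)$ and $m^*_{p,q}=\int_0^\infty(1+t^q)^{-1/p}\,dt\in(0,+\infty]$ (the value is $+\infty$ exactly when $p\ge q$). The function $\sinh_{p,q}:(0,m^*_{p,q})\to(0,\infty)$ denotes the inverse of $\mathrm{arcsinh}_{p,q}$. One has $\pi_{p,q}/2>1$ and $m^*_{p,q}>1$, so $(0,1)$ is contained in the domains of both $\sin_{p,q}$ and $\sinh_{p,q}$ and the inequalities are meaningful. *)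

theory Defs
  imports "HOL-Analysis.Analysis"
begin

(* Note 0 powr q = 0 for every q, so the integrands have the expected value at t = 0.
   At t = 1 the integrand of arcsin_pq takes the value 0 powr (-1/p) = 0 in HOL; this
   single point does not affect the integral. *)

definition arcsin_pq :: "real \<Rightarrow> real \<Rightarrow> real \<Rightarrow> real" where
  "arcsin_pq p q x = integral {0..x} (\<lambda>t. (1 - t powr q) powr (- 1 / p))"

definition arcsinh_pq :: "real \<Rightarrow> real \<Rightarrow> real \<Rightarrow> real" where
  "arcsinh_pq p q x = integral {0..x} (\<lambda>t. (1 + t powr q) powr (- 1 / p))"

(* The inverses are meaningful on the images arcsin_pq p q ` {0..1} = {0..pi_pq/2} and
   arcsinh_pq p q ` {0<..} = {0<..<m*_pq} only; for p, q > 1 both contain {0<..<1}. *)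

definition sin_pq :: "real \<Rightarrow> real \<Rightarrow> real \<Rightarrow> real" where
  "sin_pq p q = the_inv_into {0..1} (arcsin_pq p q)"

definition sinh_pq :: "real \<Rightarrow> real \<Rightarrow> real \<Rightarrow> real" where
  "sinh_pq p q = the_inv_into {0<..} (arcsinh_pq p q)"

end

theory Submission
  imports Defs
begin

text \<open>
  The claim says that \<open>sin_pq\<close> is log-concave and \<open>sinh_pq\<close> log-convex
  in the logarithm of the argument. For inverse functions this turns around: it suffices that
  \<open>F = arcsin_pq\<close> satisfies \<open>F (sqrt (x y))\<^sup>2 \<le> F x * F y\<close> and that
  \<open>F = arcsinh_pq\<close> satisfies the opposite inequality, since both functions increase.

  Write \<open>f\<close> for the integrand. With \<open>m = sqrt (x y)\<close>, \<open>x \<le> y\<close> and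
  \<open>k = y / m = m / x\<close>, the inequality for \<open>arcsinh_pq\<close> compares
  \<open>F (k x) / F x\<close> with \<open>F (k m) / F m\<close>. So one needs that
  \<open>z \<mapsto> F (k z) / F z\<close> is decreasing. By the monotone form of l'Hopital's rule this
  follows from the same property of the integrands, that is, of \<open>f (k t) / f t\<close>, and this
  ratio is \<open>((1 + t\<^sup>q) / (1 + (k t)\<^sup>q))\<close> to the power \<open>1 / p\<close>, which
  decreases for \<open>k \<ge> 1\<close>. For \<open>arcsin_pq\<close> the sign of \<open>t\<^sup>q\<close> is
  reversed, and the ratio decreases for \<open>k \<le> 1\<close> instead, which exchanges the roles of
  \<open>x\<close> and \<open>y\<close>. The monotone rule is \<open>integral_dilation_ratio\<close>, and the
  two applications are \<open>arcsin_pq_geometric_mean\<close> and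
  \<open>arcsinh_pq_geometric_mean\<close>.

  The inverse functions are only meaningful on the images of \<open>arcsin_pq\<close> and
  \<open>arcsinh_pq\<close>, so these have to be shown to contain the unit interval.
  For \<open>arcsin_pq\<close> this holds because the integrand is at least 1, which gives
  \<open>arcsin_pq x \<ge> x\<close>. For \<open>arcsinh_pq\<close> the explicit minorant
  \<open>x * (1 + x powr q) powr (- 1 / q)\<close>, which increases to 1 at infinity, does the same (\<open>arcsinh_pq_lower_bound\<close>).
\<close>

section \<open>Ratios of dilated integrals\<close>

text \<open>
  A monotone l'Hopital rule without derivatives. Let \<open>\<rho> = f (k z) / f z\<close>. Since
  \<open>f (k t) / f t\<close> decreases, the integral of \<open>f (k t)\<close> is at least \<open>\<rho>\<close>
  times that of \<open>f\<close> to the left of \<open>z\<close>, and at most \<open>\<rho>\<close> times that of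
  \<open>f\<close> to the right of \<open>z\<close>. Extending the interval from \<open>z\<close> to
  \<open>w\<close> can therefore only lower the quotient of the two integrals. The dilation
  factor may lie on either side of 1: the hyperbolic case has \<open>k \<ge> 1\<close>, the circular
  one \<open>k \<le> 1\<close>.
\<close>

lemma integral_dilation_ratio:
  fixes f :: "real \<Rightarrow> real"
  assumes k: "k > 0" and zw: "0 \<le> z" "z \<le> w"
    and int: "f integrable_on {0..w}" "f integrable_on {0..k * w}"
    and pos: "\<And>t. t \<in> {0..w} \<Longrightarrow> 0 < f t"
    and ratio: "\<And>t u. 0 \<le> t \<Longrightarrow> t \<le> u \<Longrightarrow> u \<le> w \<Longrightarrow> f t * f (k * u) \<le> f (k * t) * f u"
  shows "integral {0..z} f * integral {0..k * w} f \<le> integral {0..k * z} f * integral {0..w} f"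
proof -
  define g where "g = (\<lambda>t. f (k * t))"
  have dil: "(g has_integral (integral {0..k * v} f / k)) {0..v}" if "0 \<le> v" "v \<le> w" for v
  proof -
    have "f integrable_on {0..k * v}"
      by (rule integrable_subinterval_real[OF int(2)]) (use k that in auto)
    then have "(g has_integral (1 / \<bar>k\<bar>) *\<^sub>R integral {0..k * v} f) ((\<lambda>x. x / k) ` {0..k * v})"
      unfolding g_def by (intro has_integral_stretch_real) (use k in auto)
    moreover have "(\<lambda>x. x / k) ` {0..k * v} = {0..v}"
      using k that by simp
    ultimately show ?thesis using k by (simp add: field_simps)
  qed
  have g_int: "g integrable_on {0..w}"
    using dil[of w] zw by (auto simp: has_integral_iff)
  have sub: "h integrable_on {a..b}"
    if "h integrable_on {0..w}" "0 \<le> a" "b \<le> w" for h :: "real \<Rightarrow> real" and a b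
    by (rule integrable_subinterval_real[OF that(1)]) (use that in auto)
  define \<rho> where "\<rho> = g z / f z"
  have fz: "f z > 0" using pos zw by auto
  have head: "\<rho> * integral {0..z} f \<le> integral {0..z} g"
  proof -
    have "integral {0..z} (\<lambda>t. \<rho> * f t) \<le> integral {0..z} g"
    proof (intro integral_le integrable_on_mult_right sub[OF int(1)] sub[OF g_int])
      show "\<rho> * f t \<le> g t" if "t \<in> {0..z}" for t
        using ratio[of t z] that zw fz by (simp add: \<rho>_def g_def field_simps)
    qed (use zw in auto)
    then show ?thesis by simp
  qed
  have tail: "integral {z..w} g \<le> \<rho> * integral {z..w} f"
  proof -
    have "integral {z..w} g \<le> integral {z..w} (\<lambda>t. \<rho> * f t)"
    proof (intro integral_le integrable_on_mult_right sub[OF int(1)] sub[OF g_int])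
      show "g u \<le> \<rho> * f u" if "u \<in> {z..w}" for u
        using ratio[of z u] that zw fz by (simp add: \<rho>_def g_def field_simps)
    qed (use zw in auto)
    then show ?thesis by simp
  qed
  define A B where "A = integral {0..z} f" and "B = integral {z..w} f"
  have nonneg: "0 \<le> A" "0 \<le> B"
    unfolding A_def B_def using zw
    by (auto intro!: integral_nonneg sub[OF int(1)] pos[THEN less_imp_le])
  have "A * integral {z..w} g \<le> A * (\<rho> * B)"
    using tail nonneg by (intro mult_left_mono) (auto simp: B_def)
  also have "\<dots> = (\<rho> * A) * B" by simp
  also have "\<dots> \<le> integral {0..z} g * B"
    using head nonneg by (intro mult_right_mono) (auto simp: A_def)
  finally have "A * (integral {0..z} g + integral {z..w} g) \<le> integral {0..z} g * (A + B)"
    by (simp add: algebra_simps)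
  moreover have "A + B = integral {0..w} f"
    unfolding A_def B_def by (rule Henstock_Kurzweil_Integration.integral_combine) (use zw int in auto)
  moreover have "integral {0..z} g + integral {z..w} g = integral {0..w} g"
    by (rule Henstock_Kurzweil_Integration.integral_combine) (use zw g_int in auto)
  moreover have "integral {0..v} g = integral {0..k * v} f / k" if "0 \<le> v" "v \<le> w" for v
    using dil[OF that] by (rule integral_unique)
  ultimately have "A * (integral {0..k * w} f / k) \<le> integral {0..k * z} f / k * integral {0..w} f"
    using zw by simp
  then show ?thesis using k by (simp add: A_def divide_right_mono field_simps)
qed

section \<open>The generalized arcsine\<close>

lemma arcsin_integrand_ge_1:
  fixes p q t :: real
  assumes "p > 1" "q > 1" "0 \<le> t" "t < 1"
  shows "1 \<le> (1 - t powr q) powr (- 1 / p)"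
proof -
  have "t powr q < 1"
    using assms powr_less_mono2[of q t 1] by simp
  then have "1 powr (- 1 / p) \<le> (1 - t powr q) powr (- 1 / p)"
    using assms by (intro powr_mono2') auto
  then show ?thesis by simp
qed

text \<open>
  The singularity at 1 is no worse than that of \<open>(1 - t) powr (- 1 / p)\<close>, because
  \<open>t powr q \<le> t\<close> on the unit interval; and \<open>- 1 / p > - 1\<close>.
\<close>

lemma arcsin_integrand_integrable:
  fixes p q :: real
  assumes p: "p > 1" and q: "q > 1"
  shows "(\<lambda>t. (1 - t powr q) powr (- 1 / p)) integrable_on {0..1}"
proof (rule measurable_bounded_by_integrable_imp_integrable_real)
  have "(\<lambda>t. (1 - t powr q) powr (- 1 / p)) \<in> borel_measurable borel"
    by measurable
  then show "(\<lambda>t. (1 - t powr q) powr (- 1 / p)) \<in> borel_measurable (lebesgue_on {0..1})"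
    by (intro measurable_restrict_space1 measurable_completion) auto
  have "(\<lambda>t. t powr (- 1 / p)) integrable_on {0..1}"
    using p by (intro integrable_on_powr_from_0) (auto simp: field_simps)
  then have "(\<lambda>t. t powr (- 1 / p)) integrable_on cbox 0 1"
    by simp
  from integrable_affinity[OF this, of "-1" 1]
  show "(\<lambda>t. (1 - t) powr (- 1 / p)) integrable_on {0..1}"
    by simp
  show "\<bar>(1 - t powr q) powr (- 1 / p)\<bar> \<le> (1 - t) powr (- 1 / p)" if t: "t \<in> {0..1}" for t
  proof (cases "t = 1")
    case False
    have "t powr q \<le> t powr 1"
      using t q powr_mono'[of 1 q t] by auto
    then have "(1 - t powr q) powr (- 1 / p) \<le> (1 - t) powr (- 1 / p)"
      using t False p by (intro powr_mono2') auto
    then show ?thesis by simp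
  qed simp
qed auto

lemma arcsin_pq_increment:
  fixes p q x y :: real
  assumes p: "p > 1" and q: "q > 1" and xy: "0 \<le> x" "x \<le> y" "y \<le> 1"
  shows "y - x \<le> arcsin_pq p q y - arcsin_pq p q x"
proof -
  let ?f = "\<lambda>t. (1 - t powr q) powr (- 1 / p)"
  have int: "?f integrable_on {a..b}" if "0 \<le> a" "b \<le> 1" for a b
    by (rule integrable_subinterval_real[OF arcsin_integrand_integrable[OF p q]]) (use that in auto)
  \<comment> \<open>At 1 the integrand is \<open>0 powr (- 1 / p) = 0\<close>, so the lower bound 1 fails there.\<close>
  have "((\<lambda>t. 1 :: real) has_integral (y - x)) {x..y}"
    using has_integral_const_real[of "1 :: real" x y] xy by simp
  then have "((\<lambda>t. if t = 1 then 0 else 1 :: real) has_integral (y - x)) {x..y}"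
    by (rule has_integral_spike_finite[of "{1}", rotated 2]) auto
  moreover have "(?f has_integral integral {x..y} ?f) {x..y}"
    using int xy by blast
  ultimately have "y - x \<le> integral {x..y} ?f"
    by (rule has_integral_le) (use arcsin_integrand_ge_1[OF p q] xy in auto)
  also have "integral {0..x} ?f + integral {x..y} ?f = integral {0..y} ?f"
    using Henstock_Kurzweil_Integration.integral_combine[of 0 x y ?f] int[of 0 y] xy by auto
  then have "integral {x..y} ?f = arcsin_pq p q y - arcsin_pq p q x"
    by (simp add: arcsin_pq_def)
  finally show ?thesis .
qed

lemma arcsin_pq_0 [simp]: "arcsin_pq p q 0 = 0"
  by (simp add: arcsin_pq_def)

text \<open>
  As \<open>arcsin_pq r \<ge> r\<close>, the preimage of \<open>r\<close> is already found in
  \<open>{0..r}\<close>. So \<open>sin_pq r \<le> r\<close> is bounded away from the singularity, which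
  is what \<open>arcsin_pq_geometric_mean\<close> requires of its arguments.
\<close>

lemma sin_pq_inverse:
  fixes p q r :: real
  assumes p: "p > 1" and q: "q > 1" and r: "0 < r" "r < 1"
  shows "0 < sin_pq p q r" "sin_pq p q r < 1" "arcsin_pq p q (sin_pq p q r) = r"
proof -
  have inj: "inj_on (arcsin_pq p q) {0..1}"
  proof (rule linorder_inj_onI)
    show "arcsin_pq p q x \<noteq> arcsin_pq p q y" if "x < y" "x \<in> {0..1}" "y \<in> {0..1}" for x y
      using arcsin_pq_increment[OF p q, of x y] that by auto
  qed auto
  have "continuous_on {0..1} (arcsin_pq p q)"
    unfolding arcsin_pq_def
    by (rule indefinite_integral_continuous_1[OF arcsin_integrand_integrable[OF p q]])
  then have "\<exists>x. 0 \<le> x \<and> x \<le> r \<and> arcsin_pq p q x = r"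
    using r arcsin_pq_increment[OF p q, of 0 r]
    by (intro IVT') (auto elim: continuous_on_subset)
  then obtain x where x: "0 \<le> x" "x \<le> r" "arcsin_pq p q x = r" by blast
  then have "sin_pq p q r = x"
    unfolding sin_pq_def using inj r by (intro the_inv_into_f_eq) auto
  moreover have "x \<noteq> 0" using x(3) r by auto
  ultimately show "0 < sin_pq p q r" "sin_pq p q r < 1" "arcsin_pq p q (sin_pq p q r) = r"
    using x r by auto
qed

text \<open>
  The dilation goes downwards, with \<open>k = sqrt (x / y) \<le> 1\<close>, and takes \<open>y\<close> to
  \<open>m\<close> and \<open>m\<close> to \<open>x\<close>. The hypothesis on the ratio of integrands reduces
  to \<open>(1 - K) (U - T) \<ge> 0\<close> for the \<open>q\<close>-th powers of \<open>k\<close>,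
  \<open>u\<close> and \<open>t\<close>.
\<close>

lemma arcsin_pq_geometric_mean:
  fixes p q x y :: real
  assumes p: "p > 1" and q: "q > 1" and "0 < x" "x < 1" "0 < y" "y < 1"
  shows "(arcsin_pq p q (sqrt (x * y)))\<^sup>2 \<le> arcsin_pq p q x * arcsin_pq p q y"
  using assms(3-)
proof (induction x y rule: linorder_wlog)
  case (le x y)
  let ?f = "\<lambda>t. (1 - t powr q) powr (- 1 / p)"
  define k m where "k = sqrt (x / y)" and "m = sqrt (x * y)"
  have k: "0 < k" "k \<le> 1" using le by (auto simp: k_def)
  have km: "k * y = m" "k * m = x"
    using le by (auto simp: k_def m_def real_sqrt_divide real_sqrt_mult field_simps)
  have m: "0 \<le> m" "m \<le> y"
    using le k mult_left_le_one_le[of y k] unfolding km(1) by (auto simp: m_def)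
  have int: "?f integrable_on {0..b}" if "b \<le> 1" for b
    by (rule integrable_subinterval_real[OF arcsin_integrand_integrable[OF p q]]) (use that in auto)
  have "integral {0..m} ?f * integral {0..k * y} ?f \<le> integral {0..k * m} ?f * integral {0..y} ?f"
  proof (rule integral_dilation_ratio[OF k(1) m])
    show "0 < ?f t" if "t \<in> {0..y}" for t
      using arcsin_integrand_ge_1[OF p q, of t] that le by (auto simp del: powr_gt_zero)
    show "?f t * ?f (k * u) \<le> ?f (k * t) * ?f u" if tu: "0 \<le> t" "t \<le> u" "u \<le> y" for t u
    proof -
      define T U K where "T = t powr q" and "U = u powr q" and "K = k powr q"
      have TU: "0 \<le> T" "T \<le> U" "U < 1"
        using tu le q powr_less_mono2[of q u 1] by (auto simp: T_def U_def intro: powr_mono2)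
      have K: "0 \<le> K" "K \<le> 1"
        using k q powr_le1[of q k] by (auto simp: K_def)
      have KT: "K * v < 1" if "0 \<le> v" "v < 1" for v
        using K that mult_left_le_one_le[of v K] by linarith
      have "0 \<le> (1 - K) * (U - T)" using K TU by simp
      then have "(1 - K * T) * (1 - U) \<le> (1 - T) * (1 - K * U)"
        by (simp add: algebra_simps)
      then have "((1 - T) * (1 - K * U)) powr (- 1 / p) \<le> ((1 - K * T) * (1 - U)) powr (- 1 / p)"
        using p TU KT by (intro powr_mono2') auto
      then show ?thesis
        using k tu TU KT[of U] KT[of T]
        by (simp add: powr_mult T_def U_def K_def)
    qed
  qed (use int le m km in auto)
  then show ?case
    unfolding km m_def[symmetric] by (simp add: arcsin_pq_def power2_eq_square)
next
  case (sym x y)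
  then show ?case by (simp add: mult.commute)
qed

section \<open>The generalized hyperbolic arcsine\<close>

lemma arcsinh_integrand_continuous:
  fixes q c a b :: real
  assumes "q > 1" "0 \<le> a"
  shows "continuous_on {a..b} (\<lambda>t. (1 + t powr q) powr c)"
proof -
  have "1 + t powr q \<noteq> 0" for t :: real
    using powr_ge_zero[of t q] by linarith
  moreover have "continuous_on {a..b} (\<lambda>t. t powr q)"
    using assms by (intro continuous_on_powr' continuous_intros) auto
  ultimately show ?thesis
    by (auto intro: continuous_on_powr[OF continuous_on_add[OF continuous_on_const]
          continuous_on_const])
qed

lemma arcsinh_integrand_integrable:
  fixes p q :: real
  assumes "q > 1" "0 \<le> a"
  shows "(\<lambda>t. (1 + t powr q) powr (- 1 / p)) integrable_on {a..b}"
  using assms by (intro integrable_continuous_real arcsinh_integrand_continuous)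

lemma arcsinh_pq_0 [simp]: "arcsinh_pq p q 0 = 0"
  by (simp add: arcsinh_pq_def)

lemma arcsinh_pq_strict_mono:
  fixes p q x y :: real
  assumes q: "q > 1" and xy: "0 \<le> x" "x < y"
  shows "arcsinh_pq p q x < arcsinh_pq p q y"
proof -
  let ?f = "\<lambda>t. (1 + t powr q) powr (- 1 / p)"
  have pos: "0 < ?f t" for t
    using powr_ge_zero[of t q] by (simp add: add_nonneg_eq_0_iff)
  have "integral {x..y} (\<lambda>t. 0) < integral {x..y} ?f"
    by (rule integral_less_real)
      (use pos xy q arcsinh_integrand_continuous in auto)
  moreover have "integral {0..x} ?f + integral {x..y} ?f = integral {0..y} ?f"
    using Henstock_Kurzweil_Integration.integral_combine[of 0 x y ?f] arcsinh_integrand_integrable[OF q, of 0] xy by auto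
  ultimately show ?thesis by (simp add: arcsinh_pq_def)
qed

text \<open>
  The derivative of the left-hand side is \<open>(1 + x powr q) powr (- 1 / q - 1)\<close>, whose
  exponent is less than \<open>- 1 < - 1 / p\<close>, so it stays below the integrand. This bound
  stands in for the evaluation of the complete integral by the beta function.
\<close>

lemma arcsinh_pq_lower_bound:
  fixes p q x :: real
  assumes p: "p > 1" and q: "q > 1" and x: "0 \<le> x"
  shows "x * (1 + x powr q) powr (- 1 / q) \<le> arcsinh_pq p q x"
proof -
  let ?f = "\<lambda>t. (1 + t powr q) powr (- 1 / p)"
  let ?G = "\<lambda>t. t * (1 + t powr q) powr (- 1 / q)"
  let ?g = "\<lambda>t. (1 + t powr q) powr (- 1 / q - 1)"
  have base: "1 \<le> 1 + t powr q" for t :: real by simp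
  have ne: "1 + t powr q \<noteq> 0" for t :: real using base[of t] by linarith
  have "(?g has_integral (?G x - ?G 0)) {0..x}"
  proof (rule fundamental_theorem_of_calculus_interior)
    show "continuous_on {0..x} ?G"
      using q by (intro continuous_intros arcsinh_integrand_continuous) auto
    show "(?G has_vector_derivative ?g t) (at t)" if "t \<in> {0<..<x}" for t
    proof -
      have t: "t > 0" using that by simp
      have split: "(1 + t powr q) powr (- 1 / q) = (1 + t powr q) * ?g t"
        using ne[of t] base[of t] by (simp add: powr_diff)
      have tq: "t * t powr (q - 1) = t powr q"
        using t by (simp add: powr_diff)
      have deriv: "((\<lambda>t. 1 + t powr q) has_real_derivative q * t powr (q - 1)) (at t)"
        using has_real_derivative_powr[OF t, of q] DERIV_add[OF DERIV_const[of 1]] by fastforce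
      have "((\<lambda>t. (1 + t powr q) powr (- 1 / q)) has_real_derivative
          - 1 / q * ?g t * (q * t powr (q - 1))) (at t)"
        using DERIV_fun_powr[OF deriv, of "- 1 / q"] base[of t] q by simp
      from DERIV_mult[OF DERIV_ident this]
      have "(?G has_real_derivative
          (1 + t powr q) powr (- 1 / q) - t * t powr (q - 1) * ?g t) (at t)"
        using q by (simp add: field_simps)
      also have "(1 + t powr q) powr (- 1 / q) - t * t powr (q - 1) * ?g t = ?g t"
        unfolding split tq by (simp add: algebra_simps)
      finally show ?thesis
        by (simp add: has_real_derivative_iff_has_vector_derivative)
    qed
  qed (use x in auto)
  then have "(?g has_integral ?G x) {0..x}" by simp
  moreover have "(?f has_integral integral {0..x} ?f) {0..x}"
    using arcsinh_integrand_integrable[OF q] by blast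
  ultimately have "?G x \<le> integral {0..x} ?f"
  proof (rule has_integral_le)
    fix t
    have "- 1 / q - 1 \<le> - 1 / p"
    proof -
      have "1 / p \<le> 1" "0 \<le> 1 / q" using p q by (auto simp: field_simps)
      then show ?thesis unfolding minus_divide_left[symmetric] by linarith
    qed
    then show "?g t \<le> ?f t" using base[of t] by (intro powr_mono) auto
  qed
  then show ?thesis by (simp add: arcsinh_pq_def)
qed

lemma sinh_pq_inverse:
  fixes p q r :: real
  assumes p: "p > 1" and q: "q > 1" and r: "0 < r" "r < 1"
  shows "0 < sinh_pq p q r" "arcsinh_pq p q (sinh_pq p q r) = r"
proof -
  have inj: "inj_on (arcsinh_pq p q) {0<..}"
  proof (rule linorder_inj_onI)
    show "arcsinh_pq p q x \<noteq> arcsinh_pq p q y" if "x < y" "x \<in> {0<..}" "y \<in> {0<..}" for x y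
      using arcsinh_pq_strict_mono[OF q, of x y p] that by auto
  qed auto
  \<comment> \<open>\<open>X\<close> is the point at which the minorant of \<open>arcsinh_pq_lower_bound\<close> takes the value \<open>r\<close>.\<close>
  define D where "D = 1 - r powr q"
  have D: "0 < D" using q r powr_less_mono2[of q r 1] by (simp add: D_def)
  define X where "X = r * D powr (- 1 / q)"
  have X: "0 < X" using D r by (simp add: X_def)
  have "X powr q = (1 - D) / D"
    using D r q by (simp add: X_def powr_mult powr_powr powr_minus_divide powr_divide)
      (simp add: D_def)
  then have "1 + X powr q = 1 / D"
    using D by (simp add: field_simps)
  moreover have "(1 / D) powr (- 1 / q) = D powr (1 / q)"
    using D by (simp add: powr_divide powr_minus field_simps)
  ultimately have "X * (1 + X powr q) powr (- 1 / q) = r"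
    using D by (simp add: X_def powr_minus)
  then have "r \<le> arcsinh_pq p q X"
    using arcsinh_pq_lower_bound[OF p q, of X] X by simp
  moreover have "continuous_on {0..X} (arcsinh_pq p q)"
    unfolding arcsinh_pq_def
    by (rule indefinite_integral_continuous_1[OF arcsinh_integrand_integrable[OF q order_refl]])
  ultimately have "\<exists>x. 0 \<le> x \<and> x \<le> X \<and> arcsinh_pq p q x = r"
    using X r by (intro IVT') auto
  then obtain x where x: "0 \<le> x" "arcsinh_pq p q x = r" by blast
  moreover have "x \<noteq> 0" using x(2) r by auto
  ultimately have "sinh_pq p q r = x" "0 < x"
    unfolding sinh_pq_def using inj by (auto intro!: the_inv_into_f_eq)
  then show "0 < sinh_pq p q r" "arcsinh_pq p q (sinh_pq p q r) = r"
    using x by auto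
qed

text \<open>
  Here the dilation goes upwards, with \<open>k = sqrt (y / x) \<ge> 1\<close>, and takes \<open>x\<close> to
  \<open>m\<close> and \<open>m\<close> to \<open>y\<close>.
\<close>

lemma arcsinh_pq_geometric_mean:
  fixes p q x y :: real
  assumes p: "p > 1" and q: "q > 1" and "0 < x" "0 < y"
  shows "arcsinh_pq p q x * arcsinh_pq p q y \<le> (arcsinh_pq p q (sqrt (x * y)))\<^sup>2"
  using assms(3-)
proof (induction x y rule: linorder_wlog)
  case (le x y)
  let ?f = "\<lambda>t. (1 + t powr q) powr (- 1 / p)"
  define k m where "k = sqrt (y / x)" and "m = sqrt (x * y)"
  have k: "1 \<le> k" using le by (auto simp: k_def)
  have km: "k * x = m" "k * m = y"
    using le by (auto simp: k_def m_def real_sqrt_divide real_sqrt_mult field_simps)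
  have xm: "x \<le> m"
    using le k by (simp flip: km(1))
  have "integral {0..x} ?f * integral {0..k * m} ?f \<le> integral {0..k * x} ?f * integral {0..m} ?f"
  proof (rule integral_dilation_ratio)
    show "0 < ?f t" for t
      using powr_ge_zero[of t q] by (simp add: add_nonneg_eq_0_iff)
    show "?f t * ?f (k * u) \<le> ?f (k * t) * ?f u" if tu: "0 \<le> t" "t \<le> u" for t u
    proof -
      define T U K where "T = t powr q" and "U = u powr q" and "K = k powr q"
      have TU: "0 \<le> T" "T \<le> U"
        using tu q by (auto simp: T_def U_def intro: powr_mono2)
      have K: "1 \<le> K"
        using k q by (simp add: K_def ge_one_powr_ge_zero)
      have "0 \<le> (K - 1) * (U - T)" using K TU by simp
      then have "(1 + K * T) * (1 + U) \<le> (1 + T) * (1 + K * U)"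
        by (simp add: algebra_simps)
      then have "((1 + T) * (1 + K * U)) powr (- 1 / p) \<le> ((1 + K * T) * (1 + U)) powr (- 1 / p)"
        using p TU K by (intro powr_mono2') (auto intro!: mult_pos_pos add_pos_nonneg)
      then show ?thesis
        using k tu TU K
        by (simp add: powr_mult T_def U_def K_def)
    qed
  qed (use k le xm arcsinh_integrand_integrable[OF q] in auto)
  then show ?case
    unfolding km m_def[symmetric] by (simp add: arcsinh_pq_def power2_eq_square)
next
  case (sym x y)
  then show ?case by (simp add: mult.commute)
qed

section \<open>Passing to the inverse functions\<close>

theorem mainTheorem2:
  fixes p q r s :: real
  assumes "p \<in> {1<..}" and "q \<in> {1<..}"
    and "r \<in> {0<..<1}" and "s \<in> {0<..<1}"
  shows "sin_pq p q (sqrt (r * s)) \<ge> sqrt (sin_pq p q r * sin_pq p q s)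
    \<and> sinh_pq p q (sqrt (r * s)) \<le> sqrt (sinh_pq p q r * sinh_pq p q s)"
proof -
  have p: "p > 1" and q: "q > 1" and r: "0 < r" "r < 1" and s: "0 < s" "s < 1"
    using assms by auto
  have bound: "0 < sqrt (a * b)" "sqrt (a * b) < 1"
    if "0 < a" "a < 1" "0 < b" "b < 1" for a b :: real
    using that mult_strict_mono[of a 1 b 1] by auto
  note m = bound[OF r s]
  show ?thesis
  proof (intro conjI)
    note a = sin_pq_inverse[OF p q r] and b = sin_pq_inverse[OF p q s]
      and c = sin_pq_inverse[OF p q m]
    note ab = bound[OF a(1,2) b(1,2)]
    have "(arcsin_pq p q (sqrt (sin_pq p q r * sin_pq p q s)))\<^sup>2 \<le> r * s"
      using arcsin_pq_geometric_mean[OF p q a(1,2) b(1,2)] a(3) b(3) by simp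
    then have "arcsin_pq p q (sqrt (sin_pq p q r * sin_pq p q s))
        \<le> arcsin_pq p q (sin_pq p q (sqrt (r * s)))"
      unfolding c(3) by (rule real_le_rsqrt)
    then show "sin_pq p q (sqrt (r * s)) \<ge> sqrt (sin_pq p q r * sin_pq p q s)"
      using arcsin_pq_increment[OF p q, of "sin_pq p q (sqrt (r * s))"
          "sqrt (sin_pq p q r * sin_pq p q s)"] c ab
      by linarith
  next
    note a = sinh_pq_inverse[OF p q r] and b = sinh_pq_inverse[OF p q s]
      and c = sinh_pq_inverse[OF p q m]
    have ab: "0 < sqrt (sinh_pq p q r * sinh_pq p q s)" using a b by simp
    have "r * s \<le> (arcsinh_pq p q (sqrt (sinh_pq p q r * sinh_pq p q s)))\<^sup>2"
      using arcsinh_pq_geometric_mean[OF p q a(1) b(1)] a(2) b(2) by simp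
    moreover have "0 \<le> arcsinh_pq p q (sqrt (sinh_pq p q r * sinh_pq p q s))"
      using arcsinh_pq_strict_mono[OF q order_refl ab, of p] by simp
    ultimately have "arcsinh_pq p q (sinh_pq p q (sqrt (r * s)))
        \<le> arcsinh_pq p q (sqrt (sinh_pq p q r * sinh_pq p q s))"
      unfolding c(2) by (intro real_le_lsqrt) auto
    then show "sinh_pq p q (sqrt (r * s)) \<le> sqrt (sinh_pq p q r * sinh_pq p q s)"
      using arcsinh_pq_strict_mono[OF q, of "sqrt (sinh_pq p q r * sinh_pq p q s)"
          "sinh_pq p q (sqrt (r * s))" p] c ab
      by linarith
  qed
qed

end
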